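(* Let $G$ be a connected finite simple graph of order $n$ ($n\geq 2$) and size $m$, and let $S\subseteq V(G)$ with $|S|=\sigma$ ($0\leq\sigma\leq n$). Then $$\mathcal{E}(G_S)\geq \frac{4m}{n}.$$
   Context: The size $m$ is the number of edges of $G$ (loops are not counted). For a simple graph $G$ of order $n$ and $S\subseteq V(G)$ with $|S|=\sigma$, the self-loop graph $G_S$ is obtained from $G$ by attaching one loop at each vertex of $S$; its adjacency matrix is $A(G_S)=A(G)+\mathfrak{I}_S$, where $\mathfrak{I}_S$ is the diagonal $0/1$ matrix with ones exactly at the positions corresponding to $S$. With $\lambda_1(G_S)\ge\cdots\ge\lambda_n(G_S)$ the eigenvalues of $A(G_S)$, the energy is $\mathcal{E}(G_S)=\sum_{i=1}^n\left|\lambda_i(G_S)-\frac{\sigma}{n}\right|$. *)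

theory Defs
  imports "Graph_Theory.Graph_Theory" "Jordan_Normal_Form.Char_Poly"
begin

text \<open>
  A finite simple graph is a \<open>pair_graph\<close>: a finite, loop-free, symmetric set of ordered pairs
  of vertices. Every undirected edge is represented by two opposite arcs, so the size counts
  unordered pairs.
\<close>

definition edges :: "'a pair_pre_digraph \<Rightarrow> 'a set set" where
  "edges G = (\<lambda>(u, v). {u, v}) ` parcs G"

definition self_loop_graph :: "'a pair_pre_digraph \<Rightarrow> 'a set \<Rightarrow> 'a pair_pre_digraph" where
  "self_loop_graph G S = \<lparr>pverts = pverts G, parcs = parcs G \<union> (\<lambda>v. (v, v)) ` S\<rparr>"

text \<open>
  Matrices are indexed by \<open>0, \<dots>, n - 1\<close>, so they are taken relative to an enumeration \<open>vs\<close> of the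
  vertices (a distinct list with \<open>set vs = pverts G\<close>).
\<close>

definition adjacency_matrix :: "'a list \<Rightarrow> 'a pair_pre_digraph \<Rightarrow> real mat" where
  "adjacency_matrix vs G =
    mat (length vs) (length vs) (\<lambda>(i, j). if (vs ! i, vs ! j) \<in> parcs G then 1 else 0)"

definition indicator_matrix :: "'a list \<Rightarrow> 'a set \<Rightarrow> real mat" where
  "indicator_matrix vs S =
    mat (length vs) (length vs) (\<lambda>(i, j). if i = j \<and> vs ! i \<in> S then 1 else 0)"

lemma adjacency_matrix_self_loop_graph:
  assumes "pair_graph G" "distinct vs"
  shows "adjacency_matrix vs (self_loop_graph G S) = adjacency_matrix vs G + indicator_matrix vs S"
proof -
  interpret pair_graph G by fact
  have "(v, v) \<notin> parcs G" for v
    using no_loops by fastforce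
  then show ?thesis
    using assms(2)
    by (intro eq_matI)
       (auto simp: adjacency_matrix_def indicator_matrix_def self_loop_graph_def
          nth_eq_iff_index_eq)
qed

text \<open>
  The eigenvalues with algebraic multiplicity. Only real roots are collected; for a symmetric
  matrix these are all of them, see \<open>size_eigenvalues\<close> below.
\<close>

definition eigenvalues :: "real mat \<Rightarrow> real multiset" where
  "eigenvalues A = proots (char_poly A)"

lemma symmetric_eigenvalue_real:
  fixes A :: "real mat" and k :: complex
  assumes A: "A \<in> carrier_mat n n"
    and sym: "\<And>i j. i < n \<Longrightarrow> j < n \<Longrightarrow> A $$ (i, j) = A $$ (j, i)"
    and k: "eigenvalue (map_mat complex_of_real A) k"
  shows "k \<in> \<real>"
proof -
  obtain v where v: "v \<in> carrier_vec n" "v \<noteq> 0\<^sub>v n"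
      "map_mat complex_of_real A *\<^sub>v v = k \<cdot>\<^sub>v v"
    using k A unfolding eigenvalue_def eigenvector_def by auto
  define q where "q = (\<Sum>i<n. \<Sum>j<n. of_real (A $$ (i, j)) * cnj (v $ i) * v $ j)"
  define r where "r = (\<Sum>i<n. (cmod (v $ i))\<^sup>2)"
  have row: "(\<Sum>j<n. v $ j * of_real (A $$ (i, j))) = k * v $ i" if "i < n" for i
  proof -
    have "(\<Sum>j<n. v $ j * of_real (A $$ (i, j))) = (map_mat complex_of_real A *\<^sub>v v) $ i"
      using that A v(1) by (auto simp: scalar_prod_def lessThan_atLeast0 ac_simps intro!: sum.cong)
    also have "\<dots> = k * v $ i"
      unfolding v(3) using that v(1) by simp
    finally show ?thesis .
  qed
  have "q = (\<Sum>i<n. cnj (v $ i) * (\<Sum>j<n. v $ j * of_real (A $$ (i, j))))"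
    unfolding q_def by (simp add: sum_distrib_left algebra_simps)
  also have "\<dots> = (\<Sum>i<n. k * of_real ((cmod (v $ i))\<^sup>2))"
    by (intro sum.cong refl) (simp add: row complex_norm_square ac_simps del: of_real_power)
  also have "\<dots> = k * of_real r"
    unfolding r_def by (simp add: sum_distrib_left)
  finally have q1: "q = k * of_real r" .
  have "cnj q = (\<Sum>i<n. \<Sum>j<n. of_real (A $$ (i, j)) * v $ i * cnj (v $ j))"
    unfolding q_def by simp
  also have "\<dots> = (\<Sum>j<n. \<Sum>i<n. of_real (A $$ (i, j)) * v $ i * cnj (v $ j))"
    by (rule sum.swap)
  also have "\<dots> = q"
    unfolding q_def by (intro sum.cong refl) (simp add: sym algebra_simps)
  finally have "q \<in> \<real>"
    by (simp add: Reals_cnj_iff)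
  obtain i where i: "i < n" "v $ i \<noteq> 0"
    using v(1,2) by (auto simp: vec_eq_iff)
  have "r > 0"
    unfolding r_def using i by (intro sum_pos2[of _ i]) auto
  then have "k = q / of_real r"
    using q1 by simp
  with \<open>q \<in> \<real>\<close> show ?thesis
    by simp
qed

lemma size_eigenvalues:
  assumes A: "A \<in> carrier_mat n n"
    and sym: "\<And>i j. i < n \<Longrightarrow> j < n \<Longrightarrow> A $$ (i, j) = A $$ (j, i)"
  shows "size (eigenvalues A) = n"
proof -
  let ?C = "map_mat complex_of_real A"
  have C: "?C \<in> carrier_mat n n"
    using A by simp
  obtain as where as: "char_poly ?C = (\<Prod>a\<leftarrow>as. [:- a, 1:])" "length as = n"
    using char_poly_factorized[OF C] by blast
  have real: "complex_of_real (Re a) = a" if "a \<in> set as" for a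
  proof -
    have "poly (char_poly ?C) a = 0"
      unfolding as(1) poly_prod_list using that by (auto simp: prod_list_zero_iff)
    then have "eigenvalue ?C a"
      using eigenvalue_root_char_poly[OF C] by simp
    then show ?thesis
      using symmetric_eigenvalue_real[OF A sym] by simp
  qed
  interpret h: map_poly_inj_idom_hom complex_of_real ..
  have "map_poly complex_of_real (\<Prod>a\<leftarrow>as. [:- Re a, 1:]) = (\<Prod>a\<leftarrow>as. [:- a, 1:])"
    by (simp add: h.hom_prod_list o_def map_poly_pCons real cong: map_cong)
  also have "\<dots> = map_poly complex_of_real (char_poly A)"
    using of_real_hom.char_poly_hom[OF A, where ?'a = complex] as(1) by simp
  finally have "char_poly A = (\<Prod>a\<leftarrow>as. [:- Re a, 1:])"
    by simp
  then have "eigenvalues A = proots (\<Prod>p\<leftarrow>map (\<lambda>a. [:- Re a, 1:]) as. p)"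
    unfolding eigenvalues_def by simp
  also have "\<dots> = (\<Sum>p\<leftarrow>map (\<lambda>a. [:- Re a, 1:]) as. proots p)"
    by (rule proots_prod_list) auto
  also have "size \<dots> = length as"
    by (induction as) auto
  finally show ?thesis
    using as(2) by simp
qed

definition self_loop_energy :: "'a list \<Rightarrow> 'a pair_pre_digraph \<Rightarrow> 'a set \<Rightarrow> real" where
  "self_loop_energy vs G S =
    (\<Sum>x\<in>#eigenvalues (adjacency_matrix vs (self_loop_graph G S)).
       \<bar>x - real (card S) / real (card (pverts G))\<bar>)"

end

theory Submission
  imports Defs "Jordan_Normal_Form.Schur_Decomposition"
begin

text \<open>
  The eigenvalues of \<open>A(G\<^sub>S)\<close> sum to its trace \<open>\<sigma>\<close>, so their deviations from \<open>\<sigma>/n\<close> sum to \<open>0\<close> and the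
  energy is at least twice the largest deviation. The largest eigenvalue is at least the Rayleigh
  quotient \<open>(2m + \<sigma>)/n\<close> of the all-ones vector.

  The supremum \<open>k\<close> of the Rayleigh quotients of a symmetric matrix \<open>A\<close> is an eigenvalue: otherwise
  \<open>kI - A\<close> is positive semidefinite and invertible, hence bounded below by a positive multiple of
  the identity, and \<open>k\<close> could be decreased.
\<close>

section \<open>The sum of the eigenvalues of a symmetric matrix\<close>

text \<open>A root count equal to the degree forces the polynomial to split. Dividing out one linear
  factor lowers both numbers by one and keeps the leading coefficient, so induction on the degree
  applies to the quotient.\<close>

lemma proots_factorization:
  fixes p :: "'a :: field poly"
  assumes "p \<noteq> 0" "size (proots p) = degree p"
  shows "p = Polynomial.smult (lead_coeff p) (\<Prod>x\<in>#proots p. [:- x, 1:])"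
  using assms
proof (induction "degree p" arbitrary: p)
  case 0
  then show ?case
    by (auto simp: degree_eq_zeroE elim!: degree_eq_zeroE)
next
  case (Suc d)
  then have "proots p \<noteq> {#}"
    by force
  then obtain x where "x \<in># proots p"
    by blast
  then have "poly p x = 0"
    using Suc.prems(1) by simp
  then obtain q where p: "p = [:- x, 1:] * q"
    unfolding poly_eq_0_iff_dvd dvd_def by blast
  with Suc.prems(1) have "q \<noteq> 0"
    by auto
  have roots: "proots p = add_mset x (proots q)"
    unfolding p using \<open>q \<noteq> 0\<close> by (subst proots_mult) auto
  have deg: "degree p = Suc (degree q)"
    unfolding p using \<open>q \<noteq> 0\<close> by (subst degree_mult_eq) auto
  have lc: "lead_coeff p = lead_coeff q"
    unfolding p by (simp only: lead_coeff_mult) simp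
  have "q = Polynomial.smult (lead_coeff q) (\<Prod>y\<in>#proots q. [:- y, 1:])"
    using Suc deg roots \<open>q \<noteq> 0\<close> by auto
  then have "p = [:- x, 1:] * Polynomial.smult (lead_coeff q) (\<Prod>y\<in>#proots q. [:- y, 1:])"
    using p by simp
  then show ?case
    unfolding roots lc by (simp only: mult_smult_right image_mset_add_mset prod_mset.add_mset)
qed

text \<open>Cyclicity of the trace, from which its invariance under similarity follows.\<close>

lemma sum_diag_mult_commute:
  fixes A B :: "'a :: comm_semiring_0 mat"
  assumes "A \<in> carrier_mat n m" "B \<in> carrier_mat m n"
  shows "(\<Sum>i<n. (A * B) $$ (i, i)) = (\<Sum>j<m. (B * A) $$ (j, j))"
proof -
  have "(\<Sum>i<n. (A * B) $$ (i, i)) = (\<Sum>i<n. \<Sum>j<m. A $$ (i, j) * B $$ (j, i))"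
    using assms by (intro sum.cong refl) (auto simp: scalar_prod_def lessThan_atLeast0)
  also have "\<dots> = (\<Sum>j<m. \<Sum>i<n. B $$ (j, i) * A $$ (i, j))"
    by (subst sum.swap) (simp add: mult.commute)
  also have "\<dots> = (\<Sum>j<m. (B * A) $$ (j, j))"
    using assms by (intro sum.cong refl) (auto simp: scalar_prod_def lessThan_atLeast0)
  finally show ?thesis .
qed

text \<open>All \<open>n\<close> eigenvalues are real, so the characteristic polynomial splits over
  the reals. Schur decomposition then gives a similar triangular matrix with the eigenvalues on its
  diagonal, and similarity preserves the trace.\<close>

lemma sum_eigenvalues_eq_trace:
  assumes A: "A \<in> carrier_mat n n"
    and sym: "\<And>i j. i < n \<Longrightarrow> j < n \<Longrightarrow> A $$ (i, j) = A $$ (j, i)"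
  shows "sum_mset (eigenvalues A) = (\<Sum>i<n. A $$ (i, i))"
proof -
  have deg: "degree (char_poly A) = n" and monic: "lead_coeff (char_poly A) = 1"
    using degree_monic_char_poly[OF A] by auto
  then have "char_poly A \<noteq> 0"
    by auto
  obtain es where es: "mset es = eigenvalues A"
    using ex_mset by blast
  have "char_poly A = (\<Prod>x\<in>#mset es. [:- x, 1:])"
    using proots_factorization[OF \<open>char_poly A \<noteq> 0\<close>] size_eigenvalues[OF A sym] deg monic es
    by (simp add: eigenvalues_def)
  then have cp: "char_poly A = (\<Prod>x\<leftarrow>es. [:- x, 1:])"
    by (simp flip: mset_map prod_mset_prod_list)
  obtain B P Q where schur: "schur_decomposition A es = (B, P, Q)"
    by (metis prod_cases3)
  from schur_decomposition[OF A cp this]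
  have sim: "similar_mat_wit A B P Q" and diag: "diag_mat B = es"
    by auto
  note w = similar_mat_witD2[OF A sim]
  have "(\<Sum>i<n. A $$ (i, i)) = (\<Sum>i<n. (P * (B * Q)) $$ (i, i))"
    using w by (simp add: assoc_mult_mat[of P n n B n Q n])
  also have "\<dots> = (\<Sum>i<n. (B * Q * P) $$ (i, i))"
    using w by (intro sum_diag_mult_commute) auto
  also have "B * Q * P = B"
    using w by (simp add: assoc_mult_mat[of B n n Q n P n])
  also have "(\<Sum>i<n. B $$ (i, i)) = sum_list es"
    using w(5) unfolding diag[symmetric] diag_mat_def
    by (simp add: sum_list_sum_nth lessThan_atLeast0)
  finally show ?thesis
    unfolding es[symmetric] by (simp add: sum_mset_sum_list)
qed

section \<open>Rayleigh quotients and the top of the spectrum\<close>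

text \<open>Every product of two entries of \<open>v\<close> is at most \<open>v \<bullet> v\<close>
  in absolute value, so the absolute entries of \<open>A\<close> sum to a valid constant. The extra
  1 keeps it positive for the zero matrix. The bound makes the supremum of the Rayleigh quotients
  finite and also controls the form of an inverse matrix.\<close>

lemma quadratic_form_bound:
  fixes A :: "real mat"
  assumes A: "A \<in> carrier_mat n n"
  shows "\<exists>C>0. \<forall>v\<in>carrier_vec n. v \<bullet> (A *\<^sub>v v) \<le> C * (v \<bullet> v)"
proof (intro exI conjI ballI)
  let ?C = "1 + (\<Sum>i<n. \<Sum>j<n. \<bar>A $$ (i, j)\<bar>)"
  show "?C > 0"
    by (intro add_pos_nonneg sum_nonneg) auto
  fix v :: "real vec"
  assume v: "v \<in> carrier_vec n"
  have vv: "v \<bullet> v = (\<Sum>i<n. (v $ i)\<^sup>2)"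
    using v by (simp add: scalar_prod_def power2_eq_square lessThan_atLeast0)
  have entry: "A $$ (i, j) * (v $ i * v $ j) \<le> \<bar>A $$ (i, j)\<bar> * (v \<bullet> v)" if "i < n" "j < n" for i j
  proof -
    have "(v $ i)\<^sup>2 \<le> v \<bullet> v" "(v $ j)\<^sup>2 \<le> v \<bullet> v"
      unfolding vv using that by (auto intro!: member_le_sum)
    moreover have "2 * \<bar>v $ i * v $ j\<bar> \<le> (v $ i)\<^sup>2 + (v $ j)\<^sup>2"
      using sum_squares_bound[of "\<bar>v $ i\<bar>" "\<bar>v $ j\<bar>"] by (simp add: abs_mult)
    ultimately have "\<bar>v $ i * v $ j\<bar> \<le> v \<bullet> v"
      by linarith
    then have "\<bar>A $$ (i, j) * (v $ i * v $ j)\<bar> \<le> \<bar>A $$ (i, j)\<bar> * (v \<bullet> v)"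
      unfolding abs_mult[of "A $$ (i, j)"] by (intro mult_left_mono) auto
    then show ?thesis
      by linarith
  qed
  have "v \<bullet> (A *\<^sub>v v) = (\<Sum>i<n. \<Sum>j<n. A $$ (i, j) * (v $ i * v $ j))"
    using v A by (auto simp: scalar_prod_def lessThan_atLeast0 sum_distrib_left intro!: sum.cong)
  also have "\<dots> \<le> (\<Sum>i<n. \<Sum>j<n. \<bar>A $$ (i, j)\<bar> * (v \<bullet> v))"
    by (intro sum_mono entry) auto
  also have "\<dots> = (\<Sum>i<n. \<Sum>j<n. \<bar>A $$ (i, j)\<bar>) * (v \<bullet> v)"
    by (simp add: sum_distrib_right)
  also have "\<dots> \<le> ?C * (v \<bullet> v)"
    unfolding distrib_right vv by (simp add: sum_nonneg)
  finally show "v \<bullet> (A *\<^sub>v v) \<le> ?C * (v \<bullet> v)" .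
qed

lemma scalar_prod_self_pos:
  fixes v :: "real vec"
  assumes "v \<in> carrier_vec n" "v \<noteq> 0\<^sub>v n"
  shows "v \<bullet> v > 0"
proof -
  obtain i where "i < n" "v $ i \<noteq> 0"
    using assms by (auto simp: vec_eq_iff)
  then show ?thesis
    using assms(1)
    by (auto simp: scalar_prod_def zero_less_mult_iff linorder_neq_iff intro!: sum_pos2[of _ i])
qed

text \<open>
  Testing positivity at \<open>v - t w\<close>, where \<open>M w = v\<close>, for a suitable small \<open>t\<close> replaces the
  compactness of the unit sphere.
\<close>

lemma invertible_psd_imp_coercive:
  fixes M :: "real mat"
  assumes M: "M \<in> carrier_mat n n"
    and sym: "transpose_mat M = M"
    and psd: "\<And>v. v \<in> carrier_vec n \<Longrightarrow> 0 \<le> v \<bullet> (M *\<^sub>v v)"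
    and det: "det M \<noteq> 0"
  shows "\<exists>c>0. \<forall>v\<in>carrier_vec n. c * (v \<bullet> v) \<le> v \<bullet> (M *\<^sub>v v)"
proof -
  obtain N where N: "N \<in> carrier_mat n n" and MN: "M * N = 1\<^sub>m n"
    using det_non_zero_imp_unit[OF M det, of "()"]
    by (auto simp: Units_def ring_mat_simps)
  obtain C where C: "C > 0" "\<And>v. v \<in> carrier_vec n \<Longrightarrow> v \<bullet> (N *\<^sub>v v) \<le> C * (v \<bullet> v)"
    using quadratic_form_bound[OF N] by blast
  have "1 / C * (v \<bullet> v) \<le> v \<bullet> (M *\<^sub>v v)" if v: "v \<in> carrier_vec n" for v
  proof -
    define w where "w = N *\<^sub>v v"
    have w: "w \<in> carrier_vec n"
      unfolding w_def using N v by simp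
    have Mw: "M *\<^sub>v w = v"
      unfolding w_def using M N v by (simp flip: assoc_mult_mat_vec add: MN)
    \<comment> \<open>Symmetry of \<open>M\<close> moves it to the other factor, where
      \<open>M w = v\<close>.\<close>
    have wMv: "w \<bullet> (M *\<^sub>v v) = v \<bullet> v"
      using transpose_vec_mult_scalar[OF M v w] Mw sym
      by (metis M comm_scalar_prod mult_mat_vec_carrier v w)
    \<comment> \<open>The form at \<open>v - t w\<close> is \<open>v \<bullet> (M *\<^sub>v v) - 2 t
      (v \<bullet> v) + t^2 (v \<bullet> w)\<close>, where
      \<open>v \<bullet> w \<le> C (v \<bullet> v)\<close>. The coefficient
      \<open>2 t - C t^2\<close> is largest at \<open>t = 1 / C\<close>, with value
      \<open>1 / C\<close>.\<close>
    have "0 \<le> (v - (1 / C) \<cdot>\<^sub>v w) \<bullet> (M *\<^sub>v (v - (1 / C) \<cdot>\<^sub>v w))"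
      using v w by (intro psd) auto
    also have "M *\<^sub>v (v - (1 / C) \<cdot>\<^sub>v w) = M *\<^sub>v v - (1 / C) \<cdot>\<^sub>v v"
      using M v w by (simp add: mult_minus_distrib_mat_vec[of _ n n] mult_mat_vec[of _ n n] Mw)
    also have "(v - (1 / C) \<cdot>\<^sub>v w) \<bullet> (M *\<^sub>v v - (1 / C) \<cdot>\<^sub>v v) =
        v \<bullet> (M *\<^sub>v v) - 2 / C * (v \<bullet> v) + 1 / C\<^sup>2 * (v \<bullet> w)"
      using M v w
      by (simp add: minus_scalar_prod_distrib[of _ n] scalar_prod_minus_distrib[of _ n] wMv
          comm_scalar_prod[of w n v] power2_eq_square right_diff_distrib diff_divide_distrib)
    also have "1 / C\<^sup>2 * (v \<bullet> w) \<le> 1 / C\<^sup>2 * (C * (v \<bullet> v))"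
      using C(2)[OF v] C(1) unfolding w_def by (intro mult_left_mono) auto
    also have "1 / C\<^sup>2 * (C * (v \<bullet> v)) = 1 / C * (v \<bullet> v)"
      using C(1) by (simp add: power2_eq_square)
    finally show ?thesis
      by (simp add: field_simps)
  qed
  with C(1) show ?thesis
    by (intro exI[of _ "1 / C"]) auto
qed

lemma ex_eigenvalue_ge_rayleigh_quotient:
  fixes A :: "real mat"
  assumes A: "A \<in> carrier_mat n n"
    and sym: "transpose_mat A = A"
    and u: "u \<in> carrier_vec n" "u \<noteq> 0\<^sub>v n"
  shows "\<exists>k. eigenvalue A k \<and> u \<bullet> (A *\<^sub>v u) \<le> k * (u \<bullet> u)"
proof -
  define R where "R = (\<lambda>v. v \<bullet> (A *\<^sub>v v) / (v \<bullet> v)) ` (carrier_vec n - {0\<^sub>v n})"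
  define k where "k = Sup R"
  obtain C where C: "\<And>v. v \<in> carrier_vec n \<Longrightarrow> v \<bullet> (A *\<^sub>v v) \<le> C * (v \<bullet> v)"
    using quadratic_form_bound[OF A] by blast
  have bdd: "bdd_above R"
    unfolding R_def
    by (intro bdd_aboveI2[of _ _ C]) (use C scalar_prod_self_pos in \<open>auto simp: pos_divide_le_eq\<close>)
  have "R \<noteq> {}"
    unfolding R_def using u by auto
  have le: "v \<bullet> (A *\<^sub>v v) \<le> k * (v \<bullet> v)" if v: "v \<in> carrier_vec n" for v
  proof (cases "v = 0\<^sub>v n")
    case True
    then show ?thesis
      using A by (auto simp: scalar_prod_def)
  next
    case False
    then have "v \<bullet> (A *\<^sub>v v) / (v \<bullet> v) \<le> k"
      unfolding k_def R_def[symmetric] using v bdd by (intro cSup_upper) (auto simp: R_def)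
    then show ?thesis
      using scalar_prod_self_pos[OF v False] by (simp add: divide_le_eq)
  qed
  \<comment> \<open>\<open>char_matrix A k\<close> is \<open>A - k I\<close>. The sign is reversed
    to obtain a positive semidefinite matrix, and this does not affect whether the determinant
    vanishes.\<close>
  define M where "M = - char_matrix A k"
  have M: "M \<in> carrier_mat n n"
    unfolding M_def using A by simp
  have M_form: "v \<bullet> (M *\<^sub>v v) = k * (v \<bullet> v) - v \<bullet> (A *\<^sub>v v)" if "v \<in> carrier_vec n" for v
  proof -
    have "M = k \<cdot>\<^sub>m 1\<^sub>m n - A"
      unfolding M_def char_matrix_def using A by (intro eq_matI) auto
    moreover have "(k \<cdot>\<^sub>m 1\<^sub>m n) *\<^sub>v v = k \<cdot>\<^sub>v v"
      using that by (intro eq_vecI) auto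
    ultimately have "M *\<^sub>v v = k \<cdot>\<^sub>v v - A *\<^sub>v v"
      using that A by (simp add: minus_mult_distrib_mat_vec[of _ n n])
    then show ?thesis
      using that A by (simp add: scalar_prod_minus_distrib[of _ n])
  qed
  have "det M = 0"
  proof (rule ccontr)
    assume "det M \<noteq> 0"
    moreover have "transpose_mat M = M"
    proof -
      have "A $$ (i, j) = A $$ (j, i)" if "i < n" "j < n" for i j
        using that A sym by (metis carrier_matD index_transpose_mat(1))
      then show ?thesis
        unfolding M_def char_matrix_def using A by (intro eq_matI) auto
    qed
    ultimately obtain c where c: "c > 0" "\<And>v. v \<in> carrier_vec n \<Longrightarrow> c * (v \<bullet> v) \<le> v \<bullet> (M *\<^sub>v v)"
      using invertible_psd_imp_coercive[OF M] M_form le by fastforce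
    have "x \<le> k - c" if x: "x \<in> R" for x
    proof -
      obtain v where v: "v \<in> carrier_vec n" "v \<noteq> 0\<^sub>v n" "x = v \<bullet> (A *\<^sub>v v) / (v \<bullet> v)"
        using x unfolding R_def by auto
      have "v \<bullet> (A *\<^sub>v v) \<le> (k - c) * (v \<bullet> v)"
        using c(2)[OF v(1)] M_form[OF v(1)] by (simp add: algebra_simps)
      then show ?thesis
        unfolding v(3) using scalar_prod_self_pos[OF v(1,2)] by (simp add: divide_le_eq)
    qed
    then have "k \<le> k - c"
      unfolding k_def using \<open>R \<noteq> {}\<close> by (intro cSup_least)
    with c(1) show False
      by simp
  qed
  then have "eigenvalue A k"
    unfolding eigenvalue_det[OF A] M_def det_0_negate[OF char_matrix_closed[OF A]] .
  with le[OF u(1)] show ?thesis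
    by blast
qed

section \<open>Deviations with zero sum, and counting arcs\<close>

text \<open>The other members sum to \<open>- x\<close>, so by the triangle inequality their
  absolute values contribute at least as much as that of \<open>x\<close>.\<close>

lemma sum_mset_abs_ge_twice_member:
  fixes M :: "real multiset"
  assumes "x \<in># M" "sum_mset M = 0"
  shows "2 * x \<le> (\<Sum>y\<in>#M. \<bar>y\<bar>)"
proof -
  obtain M' where M: "M = add_mset x M'"
    using assms(1) by (metis insert_DiffM)
  have "\<bar>sum_mset M'\<bar> \<le> (\<Sum>y\<in>#M'. \<bar>y\<bar>)"
    by (induction M') auto
  with assms(2) show ?thesis
    unfolding M by simp
qed

text \<open>Arcs are counted by the fibres of the map to edges: symmetry puts both orientations into
  each fibre, and looplessness makes them distinct.\<close>

lemma twice_card_edges_le_card_arcs: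
  assumes "pair_graph G"
  shows "2 * card (edges G) \<le> card (parcs G)"
proof -
  interpret pair_graph G by fact
  let ?f = "\<lambda>(u, v). {u, v}"
  have "2 \<le> card {a \<in> parcs G. ?f a = e}" if e: "e \<in> edges G" for e
  proof -
    obtain a where "a \<in> parcs G" "e = ?f a"
      using e unfolding edges_def by (elim imageE)
    then obtain u v where uv: "(u, v) \<in> parcs G" "e = {u, v}"
      by (cases a) simp
    have "u \<noteq> v"
      using pair_no_loops[OF uv(1)] by simp
    then have "2 = card {(u, v), (v, u)}"
      by simp
    also have "\<dots> \<le> card {a \<in> parcs G. ?f a = e}"
    proof (rule card_mono)
      show "finite {a \<in> parcs G. ?f a = e}"
        using pair_finite_arcs by simp
      show "{(u, v), (v, u)} \<subseteq> {a \<in> parcs G. ?f a = e}"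
        using uv(1) arcs_symmetric[OF uv(1)] unfolding uv(2) by (simp add: insert_commute)
    qed
    finally show ?thesis .
  qed
  then have "(\<Sum>e\<in>edges G. 2) \<le> (\<Sum>e\<in>edges G. card {a \<in> parcs G. ?f a = e})"
    by (rule sum_mono)
  also have "\<dots> = card (parcs G)"
    unfolding edges_def card_eq_sum by (rule sum.image_gen[OF pair_finite_arcs, symmetric])
  finally show ?thesis
    by simp
qed

text \<open>The entry sum is the quadratic form at the all-ones vector, hence the numerator of its
  Rayleigh quotient.\<close>

lemma sum_adjacency_matrix:
  assumes "distinct vs" "parcs G \<subseteq> set vs \<times> set vs"
  shows "(\<Sum>i<length vs. \<Sum>j<length vs. adjacency_matrix vs G $$ (i, j)) = card (parcs G)"
proof -
  note reindex = sum.reindex_bij_betw[OF bij_betw_nth[OF assms(1) refl refl]]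
  have "(\<Sum>i<length vs. \<Sum>j<length vs. adjacency_matrix vs G $$ (i, j)) =
      (\<Sum>i<length vs. \<Sum>j<length vs. if (vs ! i, vs ! j) \<in> parcs G then 1 else 0)"
    by (simp add: adjacency_matrix_def)
  also have "\<dots> = (\<Sum>u\<in>set vs. \<Sum>v\<in>set vs. if (u, v) \<in> parcs G then 1 else 0)"
    unfolding reindex[of "\<lambda>v. if (u, v) \<in> parcs G then 1 else 0" for u]
    by (rule reindex[of "\<lambda>u. \<Sum>v\<in>set vs. if (u, v) \<in> parcs G then 1 else 0"])
  also have "\<dots> = (\<Sum>a\<in>set vs \<times> set vs. if a \<in> parcs G then 1 else 0)"
    by (simp add: sum.cartesian_product case_prod_unfold)
  also have "\<dots> = card (parcs G)"
    using assms(2) by (simp add: sum.If_cases Int_absorb1 Int_def[symmetric])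
  finally show ?thesis .
qed

section \<open>The energy bound for self-loop graphs\<close>

theorem corollary3p6:
  fixes G :: "'a pair_pre_digraph" and S :: "'a set" and vs :: "'a list" and n m \<sigma> :: nat
  assumes "pair_graph G"
    and "Digraph_Component.connected (with_proj G)"
    and "card (pverts G) = n" and "n \<ge> 2"
    and "card (edges G) = m"
    and "S \<subseteq> pverts G" and "card S = \<sigma>"
    and "distinct vs" and "set vs = pverts G"
  shows "self_loop_energy vs G S \<ge> 4 * real m / real n"
proof -
  interpret pair_graph G by fact
  let ?H = "self_loop_graph G S"
  let ?A = "adjacency_matrix vs ?H"
  let ?c = "real \<sigma> / real n"
  let ?u = "vec n (\<lambda>_. 1 :: real)"
  have len: "length vs = n"
    using assms(3,8,9) distinct_card by fastforce
  have A: "?A \<in> carrier_mat n n"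
    unfolding adjacency_matrix_def len by simp
  have "(v, u) \<in> parcs ?H" if "(u, v) \<in> parcs ?H" for u v
    using that arcs_symmetric by (auto simp: self_loop_graph_def)
  then have sym: "?A $$ (i, j) = ?A $$ (j, i)" if "i < n" "j < n" for i j
    using that unfolding adjacency_matrix_def len by auto
  have finS: "finite S"
    using assms(6) pair_finite_verts finite_subset by blast
  have loop: "(v, v) \<notin> parcs G" for v
    using pair_no_loops by fastforce
  \<comment> \<open>\<open>G\<close> has no loops, so the diagonal records exactly the loops
    attached at \<open>S\<close>.\<close>
  have "(\<Sum>i<n. ?A $$ (i, i)) = (\<Sum>i<n. if vs ! i \<in> S then 1 else 0)"
    using loop by (intro sum.cong) (auto simp: adjacency_matrix_def len self_loop_graph_def)
  also have "\<dots> = (\<Sum>v\<in>set vs. if v \<in> S then 1 else 0)"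
    using sum.reindex_bij_betw[OF bij_betw_nth[OF assms(8) refl refl]] len by simp
  also have "\<dots> = real \<sigma>"
    using assms(6,7,9) by (simp add: sum.If_cases Int_absorb1 Int_def[symmetric])
  finally have trace: "sum_mset (eigenvalues ?A) = real \<sigma>"
    using sum_eigenvalues_eq_trace[OF A sym] by simp
  \<comment> \<open>An attached loop is a single arc, whereas an edge accounts for two; hence
    \<open>2 * m + \<sigma>\<close>.\<close>
  have "card (parcs ?H) = card (parcs G) + card ((\<lambda>v. (v, v)) ` S)"
    unfolding self_loop_graph_def using loop finS pair_finite_arcs
    by simp (intro card_Un_disjoint; auto)
  also have "card ((\<lambda>v. (v, v)) ` S) = \<sigma>"
    using assms(7) by (simp add: card_image inj_on_def)
  finally have arcs: "2 * m + \<sigma> \<le> card (parcs ?H)"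
    using twice_card_edges_le_card_arcs[OF assms(1)] assms(5) by simp
  have "parcs ?H \<subseteq> set vs \<times> set vs"
    using assms(6,9) in_arcsD1 in_arcsD2 by (auto simp: self_loop_graph_def)
  from sum_adjacency_matrix[OF assms(8) this]
  have form: "?u \<bullet> (?A *\<^sub>v ?u) = card (parcs ?H)"
    using A len by (simp add: scalar_prod_def lessThan_atLeast0)
  have uu: "?u \<bullet> ?u = real n"
    by (simp add: scalar_prod_def)
  have "?u \<noteq> 0\<^sub>v n"
    using assms(4) by (auto simp: vec_eq_iff intro!: exI[of _ 0])
  moreover have "transpose_mat ?A = ?A"
    using A sym by (intro eq_matI) auto
  ultimately obtain k :: real where k: "eigenvalue ?A k" "card (parcs ?H) \<le> k * n"
    using ex_eigenvalue_ge_rayleigh_quotient[OF A, of ?u] form uu by auto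
  \<comment> \<open>\<open>proots 0\<close> is empty by convention, so being a root gives membership
    only for a nonzero polynomial.\<close>
  have "char_poly ?A \<noteq> 0"
    using degree_monic_char_poly[OF A] by auto
  then have "k \<in># eigenvalues ?A"
    using k(1) unfolding eigenvalues_def eigenvalue_root_char_poly[OF A] by simp
  \<comment> \<open>There are \<open>n\<close> eigenvalues, so the shift removes
    \<open>n * (\<sigma> / n) = \<sigma>\<close> in total, which is the trace.\<close>
  moreover have "(\<Sum>x\<in>#eigenvalues ?A. x - ?c) = 0"
  proof -
    have "(\<Sum>x\<in>#M. x - c) = sum_mset M - real (size M) * c" for M c
      by (induction M) (simp_all add: distrib_right)
    then show ?thesis
      using assms(4) by (simp add: trace size_eigenvalues[OF A sym])
  qed
  ultimately have "2 * (k - ?c) \<le> (\<Sum>y\<in>#image_mset (\<lambda>x. x - ?c) (eigenvalues ?A). \<bar>y\<bar>)"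
    by (intro sum_mset_abs_ge_twice_member) auto
  also have "\<dots> = self_loop_energy vs G S"
    unfolding self_loop_energy_def by (simp add: assms(3,7) image_mset.compositionality o_def)
  finally have "2 * (k - ?c) \<le> self_loop_energy vs G S" .
  \<comment> \<open>Subtracting \<open>\<sigma> / n\<close> leaves a deviation of at least
    \<open>2 * m / n\<close>, and doubling it gives the claim.\<close>
  moreover have "(2 * m + \<sigma>) / n \<le> k"
    using k(2) arcs assms(4) by (simp add: divide_le_eq)
  ultimately show ?thesis
    by (simp add: add_divide_distrib)
qed

end
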